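(* Let $p(x),q(x)$ be polynomials with real coefficients and fix a real number $x$ with $p(x)\neq 0$, $q(x)\neq 0$ and $p(x)^2+4q(x)>0$; write $q=q(x)$. Let $n\ge1$ and let $H_n$ be the $n\times n$ right circulant matrix with first row $(L_{p,q,1}(x),L_{p,q,2}(x),\dots,L_{p,q,n}(x))$, i.e. the matrix whose $(i,j)$ entry ($0\le i,j\le n-1$) is $L_{p,q,((j-i)\bmod n)+1}(x)$. Assume $L_{p,q,n}(x)\neq 2$. Then $$\begin{aligned}\det(H_n)={}&L_{p,q,1}(x)\left(L_{p,q,1}(x)-L_{p,q,n+1}(x)\right)^{n-1}\\&+L_{p,q,1}(x)\,q^{n-1}\left(L_{p,q,n}(x)-2\right)^{n-2}\sum_{k=1}^{n-1}\left(\frac{L_{p,q,1}(x)-L_{p,q,n+1}(x)}{qL_{p,q,n}(x)-2q}\right)^{k-1}L_{p,q,k}(x)\\&-2q^{n-1}\left(L_{p,q,n}(x)-2\right)^{n-2}\sum_{k=1}^{n-1}\left(\frac{L_{p,q,1}(x)-L_{p,q,n+1}(x)}{qL_{p,q,n}(x)-2q}\right)^{k-1}L_{p,q,k+1}(x).\end{aligned}$$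
   Context: The generalized Lucas polynomials are defined by $L_{p,q,0}(x)=2$, $L_{p,q,1}(x)=p(x)$ and $L_{p,q,n+1}(x)=p(x)L_{p,q,n}(x)+q(x)L_{p,q,n-1}(x)$ for $n\ge 1$. For $n=1$ the sums are empty. *)

theory Defs
  imports "HOL-Computational_Algebra.Polynomial" "Jordan_Normal_Form.Determinant"
begin

fun lucas_poly :: "real poly \<Rightarrow> real poly \<Rightarrow> nat \<Rightarrow> real poly" where
  "lucas_poly p q 0 = 2"
| "lucas_poly p q (Suc 0) = p"
| "lucas_poly p q (Suc (Suc n)) = p * lucas_poly p q (Suc n) + q * lucas_poly p q n"

text \<open>The first row is \<open>c 0, \<dots>, c (n - 1)\<close>. The index \<open>j - i\<close> is computed in the integers,
  since subtraction on the naturals truncates at zero.\<close>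

definition right_circulant :: "nat \<Rightarrow> (nat \<Rightarrow> 'a) \<Rightarrow> 'a mat" where
  "right_circulant n c = mat n n (\<lambda>(i, j). c (nat ((int j - int i) mod int n)))"

end

theory Submission
  imports Defs
begin

text \<open>Since \<open>L\<close> satisfies a second-order recurrence, subtracting from each row of the circulant
  \<open>p\<close> times the next row and \<open>q\<close> times the one after that leaves, in all but the last two rows, only
  \<open>a = L 1 - L (n + 1)\<close> on the diagonal and \<open>-b = -q (L n - L 0)\<close> to its right. The vector
  \<open>(1, r, \<dots>, r ^ (n - 2), 0)\<close> with \<open>r = a / b\<close> is annihilated by these rows. Replacing the first
  column by the corresponding combination of columns leaves two nonzero entries in it, and both of
  the minors in the expansion along that column are lower triangular.\<close>

lemma right_circulant_carrier [simp]: "right_circulant n c \<in> carrier_mat n n"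
  by (simp add: right_circulant_def)

lemma right_circulant_index:
  assumes "i < n" "j < n"
  shows "right_circulant n c $$ (i, j) = (if i \<le> j then c (j - i) else c (j + n - i))"
proof (cases "i \<le> j")
  case True
  have "(int j - int i) mod int n = int (j - i)"
    using assms True by (simp add: of_nat_diff)
  then show ?thesis
    using assms True by (simp add: right_circulant_def del: of_nat_diff)
next
  case False
  have "(int j - int i) mod int n = (int j - int i + int n) mod int n"
    by simp
  also have "\<dots> = int (j + n - i)"
    using assms False by (subst mod_pos_pos_trivial) auto
  finally show ?thesis
    using assms False by (simp add: right_circulant_def del: of_nat_diff)
qed

text \<open>Encodes the row operations as a left factor. Indices do not wrap around: in the last two
  rows the terms that would leave the matrix are dropped, so the factor is unit upper triangular and
  preserves determinants.\<close>

definition recurrence_mat :: "nat \<Rightarrow> 'a::comm_ring_1 \<Rightarrow> 'a \<Rightarrow> 'a mat" where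
  "recurrence_mat n p q = mat n n (\<lambda>(i, k).
     if k = i then 1 else if k = i + 1 then - p else if k = i + 2 then - q else 0)"

lemma recurrence_mat_carrier [simp]: "recurrence_mat n p q \<in> carrier_mat n n"
  by (simp add: recurrence_mat_def)

lemma det_recurrence_mat: "det (recurrence_mat n p q) = 1"
proof -
  have "upper_triangular (recurrence_mat n p q)"
    by (auto simp: upper_triangular_def recurrence_mat_def)
  then have "det (recurrence_mat n p q) = prod_list (diag_mat (recurrence_mat n p q))"
    by (rule det_upper_triangular[where n = n]) simp
  also have "\<dots> = 1"
    unfolding prod_list_diag_prod by (simp add: recurrence_mat_def)
  finally show ?thesis .
qed

lemma recurrence_mat_mult_index:
  assumes "A \<in> carrier_mat n n" "i < n" "j < n"
  shows "(recurrence_mat n p q * A) $$ (i, j) = A $$ (i, j)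
    - (if i + 1 < n then p * A $$ (i + 1, j) else 0)
    - (if i + 2 < n then q * A $$ (i + 2, j) else 0)"
proof -
  have "(recurrence_mat n p q * A) $$ (i, j) = (\<Sum>k = 0..<n.
      (if k = i then 1 else if k = i + 1 then - p else if k = i + 2 then - q else 0) * A $$ (k, j))"
    using assms by (auto simp: recurrence_mat_def scalar_prod_def intro!: sum.cong)
  \<comment> \<open>The three conditions exclude each other, so the nested conditional is a sum of
    three indicators, each selecting at most one row.\<close>
  also have "\<dots> = (\<Sum>k = 0..<n. (if k = i then A $$ (k, j) else 0)
      + ((if k = i + 1 then - p * A $$ (k, j) else 0) + (if k = i + 2 then - q * A $$ (k, j) else 0)))"
    by (intro sum.cong) auto
  also have "\<dots> = A $$ (i, j) - (if i + 1 < n then p * A $$ (i + 1, j) else 0)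
      - (if i + 2 < n then q * A $$ (i + 2, j) else 0)"
    using assms by (simp add: sum.distrib)
  finally show ?thesis .
qed

text \<open>The column operation as a right factor: \<open>A\<close> times this matrix is
  \<open>A\<close> with its first column replaced by the product of \<open>A\<close> and
  \<open>v\<close>.\<close>

definition replace_first_col_mat :: "nat \<Rightarrow> (nat \<Rightarrow> 'a::comm_ring_1) \<Rightarrow> 'a mat" where
  "replace_first_col_mat n v =
     mat n n (\<lambda>(i, j). if j = 0 then v i else if i = j then 1 else 0)"

lemma replace_first_col_mat_carrier [simp]: "replace_first_col_mat n v \<in> carrier_mat n n"
  by (simp add: replace_first_col_mat_def)

lemma det_replace_first_col_mat:
  assumes "n > 0"
  shows "det (replace_first_col_mat n v) = v 0"
proof -
  obtain m where m: "n = Suc m"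
    using assms gr0_implies_Suc by blast
  have "det (replace_first_col_mat n v) = prod_list (diag_mat (replace_first_col_mat n v))"
    by (rule det_lower_triangular[where n = n]) (auto simp: replace_first_col_mat_def)
  also have "\<dots> = v 0"
    unfolding prod_list_diag_prod m
    by (simp add: replace_first_col_mat_def prod.atLeast0_lessThan_Suc_shift del: prod.op_ivl_Suc)
  finally show ?thesis .
qed

lemma mult_replace_first_col_mat_index:
  assumes "A \<in> carrier_mat n n" "i < n" "j < n"
  shows "(A * replace_first_col_mat n v) $$ (i, j) =
    (if j = 0 then \<Sum>k = 0..<n. A $$ (i, k) * v k else A $$ (i, j))"
proof -
  have "(A * replace_first_col_mat n v) $$ (i, j) =
      (\<Sum>k = 0..<n. A $$ (i, k) * (if j = 0 then v k else if k = j then 1 else 0))"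
    using assms by (auto simp: replace_first_col_mat_def scalar_prod_def intro!: sum.cong)
  also have "\<dots> = (if j = 0 then \<Sum>k = 0..<n. A $$ (i, k) * v k else A $$ (i, j))"
  proof (cases "j = 0")
    case False
    then show ?thesis
      using assms by (simp add: if_distrib[of "(*) _"] cong: if_cong)
  qed simp
  finally show ?thesis .
qed

text \<open>Expand along the first column, where only rows \<open>m\<close> and \<open>m + 1\<close>
  contribute. Deleting that column moves the superdiagonal entries \<open>- b\<close> onto the
  diagonal of each minor, which becomes lower triangular.\<close>

lemma det_almost_lower_triangular:
  fixes A :: "'a::comm_ring_1 mat"
  assumes A: "A \<in> carrier_mat (m + 2) (m + 2)"
    and col0: "\<And>i. i < m \<Longrightarrow> A $$ (i, 0) = 0"
    and diag: "\<And>i. i < m \<Longrightarrow> A $$ (i, i + 1) = - b"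
    and upper: "\<And>i j. i < m \<Longrightarrow> i + 1 < j \<Longrightarrow> j < m + 2 \<Longrightarrow> A $$ (i, j) = 0"
  shows "det A = b ^ m * (A $$ (m, 0) * A $$ (m + 1, m + 1) - A $$ (m + 1, 0) * A $$ (m, m + 1))"
proof -
  \<comment> \<open>Of the rows \<open>m\<close> and \<open>m + 1\<close>, the one that survives the
    deletion of row \<open>i\<close> is \<open>2 * m + 1 - i\<close>; it supplies the last diagonal
    entry.\<close>
  have minor: "det (mat_delete A i 0) = (- b) ^ m * A $$ (2 * m + 1 - i, m + 1)"
    if i: "i = m \<or> i = m + 1" for i
  proof -
    have C: "mat_delete A i 0 \<in> carrier_mat (m + 1) (m + 1)"
      using A by (simp add: mat_delete_def)
    have idx: "mat_delete A i 0 $$ (k, l) = A $$ (if k < i then k else k + 1, l + 1)"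
      if "k < m + 1" "l < m + 1" for k l
      using A that by (simp add: mat_delete_def)
    have "det (mat_delete A i 0) = prod_list (diag_mat (mat_delete A i 0))"
      by (rule det_lower_triangular[OF _ C]) (use i idx upper in auto)
    also have "\<dots> = (\<Prod>k = 0..<m + 1. mat_delete A i 0 $$ (k, k))"
      using carrier_matD(1)[OF C] by (simp only: prod_list_diag_prod)
    also have "\<dots> = (\<Prod>k = 0..<m. mat_delete A i 0 $$ (k, k)) * mat_delete A i 0 $$ (m, m)"
      by simp
    also have "(\<Prod>k = 0..<m. mat_delete A i 0 $$ (k, k)) = (\<Prod>k = 0..<m. - b)"
      using i idx diag by (intro prod.cong) auto
    also have "mat_delete A i 0 $$ (m, m) = A $$ (2 * m + 1 - i, m + 1)"
      using i idx by auto
    finally show ?thesis by simp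
  qed
  have "det A = (\<Sum>i<m + 2. A $$ (i, 0) * cofactor A i 0)"
    using laplace_expansion_column[OF A] by simp
  also have "\<dots> = A $$ (m, 0) * cofactor A m 0 + A $$ (m + 1, 0) * cofactor A (m + 1) 0"
    using col0 by simp
  \<comment> \<open>The cofactor signs are \<open>(- 1) ^ m\<close> and
    \<open>(- 1) ^ (m + 1)\<close>, hence the difference in the second factor.\<close>
  also have "\<dots> = ((- 1) ^ m * (- b) ^ m) *
      (A $$ (m, 0) * A $$ (m + 1, m + 1) - A $$ (m + 1, 0) * A $$ (m, m + 1))"
    using minor[of m] minor[of "m + 1"] by (simp add: cofactor_def algebra_simps)
  also have "(- 1) ^ m * (- b) ^ m = b ^ m"
    by (simp flip: power_mult_distrib)
  finally show ?thesis .
qed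

text \<open>The case of size at least 2, for any second-order recurrence over a field with arbitrary
  initial values. Size \<open>m + 2\<close> makes \<open>m\<close> the number of rows that the row
  operations reduce fully.\<close>

theorem det_right_circulant_recurrence:
  fixes L :: "nat \<Rightarrow> 'a::field"
  assumes rec: "\<And>k. L (Suc (Suc k)) = p * L (Suc k) + q * L k"
    and "q \<noteq> 0" "L (m + 2) \<noteq> L 0"
  defines "a \<equiv> L 1 - L (m + 3)"
    and "b \<equiv> q * (L (m + 2) - L 0)"
  shows "det (right_circulant (m + 2) (\<lambda>k. L (k + 1))) =
    L 1 * a ^ (m + 1) + b ^ m * q * (L 1 * (\<Sum>k<m + 1. (a / b) ^ k * L (k + 1))
      - L 0 * (\<Sum>k<m + 1. (a / b) ^ k * L (k + 2)))"
proof -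
  define n where "n = m + 2"
  define H where "H = right_circulant n (\<lambda>k. L (k + 1))"
  define M where "M = recurrence_mat n p q * H"
  define r where "r = a / b"
  \<comment> \<open>The first \<open>m\<close> rows of \<open>M\<close> vanish in column
    \<open>m + 1\<close>, so the last entry of \<open>v\<close> may be 0; \<open>v 0 = 1\<close>
    keeps the determinant.\<close>
  define v where "v = (\<lambda>i. if i < m + 1 then r ^ i else 0)"
  define A where "A = M * replace_first_col_mat n v"
  have b: "b \<noteq> 0"
    using assms by simp
  have rec': "L (k + 2) = p * L (k + 1) + q * L k" for k
    using rec by simp
  have carr: "H \<in> carrier_mat n n" "M \<in> carrier_mat n n" "A \<in> carrier_mat n n"
    by (simp_all add: H_def M_def A_def mult_carrier_mat[where n = n])
  have H: "H $$ (i, j) = (if i \<le> j then L (j - i + 1) else L (j + n - i + 1))"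
    if "i < n" "j < n" for i j
    using that unfolding H_def by (simp add: right_circulant_index)
  have M: "M $$ (i, j) = H $$ (i, j)
    - (if i + 1 < n then p * H $$ (i + 1, j) else 0)
    - (if i + 2 < n then q * H $$ (i + 2, j) else 0)" if "i < n" "j < n" for i j
    unfolding M_def by (rule recurrence_mat_mult_index[OF carr(1) that])
  have M_top: "M $$ (i, j) = (if j = i then a else if j = i + 1 then - b else 0)"
    if i: "i < m" and j: "j < n" for i j
  proof -
    have eq: "M $$ (i, j) = H $$ (i, j) - p * H $$ (i + 1, j) - q * H $$ (i + 2, j)"
      using M i j by (simp add: n_def)
    \<comment> \<open>In the outer cases the three entries of \<open>H\<close> are consecutive terms
      of \<open>L\<close>, and the recurrence cancels them. In the middle cases the jump from
      \<open>L n\<close> back to \<open>L 1\<close> falls among the three rows and leaves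
      \<open>a\<close> or \<open>- b\<close>.\<close>
    consider "j < i" | "j = i" | "j = i + 1" | "i + 2 \<le> j" by linarith
    then show ?thesis
    proof cases
      case 1
      have "j + n - i - 1 + 2 = j + n - i + 1" "j + n - i - 1 + 1 = j + n - i"
        "j + n - (i + 1) + 1 = j + n - i" "j + n - (i + 2) + 1 = j + n - i - 1"
        using i by (auto simp: n_def)
      then show ?thesis
        using eq 1 i j rec'[of "j + n - i - 1"] H by (simp add: n_def)
    next
      case 2
      have "j + n - (i + 1) + 1 = m + 2" "j + n - (i + 2) + 1 = m + 1"
        using 2 by (auto simp: n_def)
      then show ?thesis
        using eq 2 i j rec'[of "m + 1"] H by (simp add: n_def a_def numeral_3_eq_3)
    next
      case 3
      then show ?thesis
        using eq i j rec'[of 0] H by (simp add: n_def b_def algebra_simps)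
    next
      case 4
      then obtain k where "j = i + 2 + k"
        using le_Suc_ex by blast
      then show ?thesis
        using eq i j rec'[of "k + 1"] H by (simp add: n_def)
    qed
  qed
  \<comment> \<open>Row \<open>m\<close> has only one row below it, so no \<open>q\<close> term is
    subtracted; the recurrence then leaves a multiple of \<open>q\<close>, plus \<open>a\<close> on
    the diagonal.\<close>
  have M_pen: "M $$ (m, j) = H $$ (m, j) - p * H $$ (m + 1, j)" if "j < n" for j
    using M that by (simp add: n_def)
  have M_pen_low: "M $$ (m, j) = q * L (j + 1) + (if j = m then a else 0)" if j: "j < m + 1" for j
  proof (cases "j = m")
    case True
    then show ?thesis
      using M_pen[of m] H rec'[of "m + 1"] by (simp add: n_def a_def numeral_3_eq_3)
  next
    case False
    then show ?thesis
      using j M_pen[of j] H rec'[of "j + 1"] by (simp add: n_def numeral_3_eq_3)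
  qed
  have M_pen_last: "M $$ (m, m + 1) = q * L 0"
    using M_pen[of "m + 1"] H rec'[of 0] by (simp add: n_def)
  have M_last: "M $$ (m + 1, j) = (if j = m + 1 then L 1 else L (j + 2))" if "j < n" for j
    using that M H by (auto simp: n_def)
  have A0: "A $$ (i, 0) = (\<Sum>k<m + 1. M $$ (i, k) * r ^ k)" if "i < n" for i
  proof -
    have "A $$ (i, 0) = (\<Sum>k = 0..<n. M $$ (i, k) * v k)"
      unfolding A_def using that mult_replace_first_col_mat_index[OF carr(2) that, of 0 v]
      by (simp add: n_def)
    also have "\<dots> = (\<Sum>k<m + 1. M $$ (i, k) * r ^ k)"
      by (simp add: n_def v_def atLeast0LessThan)
    finally show ?thesis .
  qed
  have AM: "A $$ (i, j) = M $$ (i, j)" if "i < n" "j < n" "j \<noteq> 0" for i j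
    unfolding A_def using mult_replace_first_col_mat_index[OF carr(2) that(1,2), of v] that by simp
  have A_top: "A $$ (i, 0) = 0" if i: "i < m" for i
  proof -
    have "A $$ (i, 0) = (\<Sum>k<m + 1. (if k = i then a * r ^ k else 0)
        + (if k = i + 1 then - b * r ^ k else 0))"
      using i by (subst A0) (auto simp: M_top n_def intro!: sum.cong)
    \<comment> \<open>Since \<open>i < m\<close>, both \<open>i\<close> and \<open>i + 1\<close> lie
      in the summation range.\<close>
    also have "\<dots> = a * r ^ i - b * r ^ (i + 1)"
      using i by (simp add: sum.distrib)
    also have "\<dots> = 0"
      using b by (simp add: r_def)
    finally show ?thesis .
  qed
  have A_pen: "A $$ (m, 0) = q * (\<Sum>k<m + 1. r ^ k * L (k + 1)) + a * r ^ m"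
  proof -
    have "A $$ (m, 0) = (\<Sum>k<m + 1. q * (r ^ k * L (k + 1)) + (if k = m then a * r ^ k else 0))"
      by (subst A0) (auto simp: M_pen_low n_def algebra_simps intro!: sum.cong)
    also have "\<dots> = q * (\<Sum>k<m + 1. r ^ k * L (k + 1)) + a * r ^ m"
      by (simp add: sum.distrib sum_distrib_left algebra_simps)
    finally show ?thesis .
  qed
  have A_last: "A $$ (m + 1, 0) = (\<Sum>k<m + 1. r ^ k * L (k + 2))"
  proof -
    have "A $$ (m + 1, 0) = (\<Sum>k<m + 1. M $$ (m + 1, k) * r ^ k)"
      by (rule A0) (simp add: n_def)
    also have "\<dots> = (\<Sum>k<m + 1. r ^ k * L (k + 2))"
      by (intro sum.cong refl) (subst M_last, auto simp: n_def)
    finally show ?thesis .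
  qed
  have "det A = det H"
    unfolding A_def M_def using carr
    by (simp add: det_mult[where n = n] mult_carrier_mat[where n = n] det_recurrence_mat
        det_replace_first_col_mat n_def v_def)
  moreover have "det A = b ^ m *
      (A $$ (m, 0) * A $$ (m + 1, m + 1) - A $$ (m + 1, 0) * A $$ (m, m + 1))"
    by (rule det_almost_lower_triangular)
      (use carr in \<open>auto simp: n_def A_top AM M_top\<close>)
  moreover have "A $$ (m + 1, m + 1) = L 1" "A $$ (m, m + 1) = q * L 0"
    using M_last[of "m + 1"] M_pen_last AM by (auto simp: n_def)
  ultimately have "det H = b ^ m * ((q * (\<Sum>k<m + 1. r ^ k * L (k + 1)) + a * r ^ m) * L 1
      - (\<Sum>k<m + 1. r ^ k * L (k + 2)) * (q * L 0))"
    by (simp only: A_pen A_last)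
  \<comment> \<open>This turns the extra \<open>a\<close> in row \<open>m\<close> into the summand
    \<open>L 1 * a ^ (m + 1)\<close> that stands outside the sums.\<close>
  moreover have "b ^ m * r ^ m = a ^ m"
    using b by (simp add: r_def flip: power_mult_distrib)
  then have "b ^ m * (a * r ^ m * L 1) = L 1 * a ^ (m + 1)"
    by (simp add: mult.left_commute mult.commute)
  ultimately show ?thesis
    unfolding H_def n_def r_def by (simp only: ring_distribs) (simp add: ac_simps)
qed

theorem theorem4:
  fixes p q :: "real poly" and x :: real and n :: nat
  defines "L \<equiv> (\<lambda>k. poly (lucas_poly p q k) x)"
  defines "qx \<equiv> poly q x"
  assumes "poly p x \<noteq> 0"
    and "poly q x \<noteq> 0"
    and "(poly p x)\<^sup>2 + 4 * poly q x > 0"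
    and "n \<ge> 1"
    and "L n \<noteq> 2"
  shows "det (right_circulant n (\<lambda>k. L (k + 1))) =
      L 1 * (L 1 - L (n + 1)) ^ (n - 1)
    + L 1 * qx ^ (n - 1) * (L n - 2) powi (int n - 2) *
        (\<Sum>k = 1..n - 1. ((L 1 - L (n + 1)) / (qx * L n - 2 * qx)) ^ (k - 1) * L k)
    - 2 * qx ^ (n - 1) * (L n - 2) powi (int n - 2) *
        (\<Sum>k = 1..n - 1. ((L 1 - L (n + 1)) / (qx * L n - 2 * qx)) ^ (k - 1) * L (k + 1))"
proof (cases "n = 1")
  case True
  \<comment> \<open>For \<open>n = 1\<close> the exponent \<open>int n - 2\<close> is -1, but both
    sums are empty and the right-hand side is \<open>L 1\<close>.\<close>
  have "det (right_circulant 1 c) = c 0" for c :: "nat \<Rightarrow> real"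
    by (subst det_single[OF right_circulant_carrier]) (simp add: right_circulant_index)
  then show ?thesis
    using True by simp
next
  case False
  then obtain m where n: "n = m + 2"
    using \<open>n \<ge> 1\<close> by (metis One_nat_def add_2_eq_Suc' le_SucE not0_implies_Suc not_one_le_zero)
  have L0: "L 0 = 2"
    by (simp add: L_def)
  have rec: "L (Suc (Suc k)) = poly p x * L (Suc k) + qx * L k" for k
    by (simp add: L_def qx_def)
  have shift: "(\<Sum>k = 1..n - 1. f k) = (\<Sum>k<m + 1. f (k + 1))" for f :: "nat \<Rightarrow> real"
    unfolding n by (rule sum.reindex_bij_witness[of _ "\<lambda>k. k + 1" "\<lambda>k. k - 1"]) auto
  have denom: "qx * L n - 2 * qx = qx * (L n - 2)"
    by (simp add: algebra_simps)
  have powi: "(L n - 2) powi (int n - 2) = (L n - 2) ^ m"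
    by (simp add: n)
  define r where "r = (L 1 - L (n + 1)) / (qx * (L n - 2))"
  have "n + 1 = m + 3" "n - 1 = m + 1"
    by (simp_all add: n)
  have "det (right_circulant n (\<lambda>k. L (k + 1))) =
      L 1 * (L 1 - L (n + 1)) ^ (m + 1) + (qx * (L n - 2)) ^ m * qx *
      (L 1 * (\<Sum>k<m + 1. r ^ k * L (k + 1)) - 2 * (\<Sum>k<m + 1. r ^ k * L (k + 2)))"
    using det_right_circulant_recurrence[of L "poly p x" qx m, OF rec] assms(4,7)
    unfolding r_def \<open>n + 1 = m + 3\<close> L0 unfolding n qx_def by simp
  moreover have "(\<Sum>k = 1..n - 1. r ^ (k - 1) * L k) = (\<Sum>k<m + 1. r ^ k * L (k + 1))"
    "(\<Sum>k = 1..n - 1. r ^ (k - 1) * L (k + 1)) = (\<Sum>k<m + 1. r ^ k * L (k + 2))"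
    unfolding shift by simp_all
  \<comment> \<open>The factor \<open>q\<close> left over from the 2 by 2 expression raises the
    power of \<open>qx\<close> from \<open>n - 2\<close> to \<open>n - 1\<close>.\<close>
  moreover have "(qx * (L n - 2)) ^ m * qx = qx ^ (m + 1) * (L n - 2) ^ m"
    by (simp add: power_mult_distrib)
  ultimately show ?thesis
    unfolding denom powi \<open>n - 1 = m + 1\<close> r_def[symmetric]
    by (simp only:) (simp only: ring_distribs mult_ac diff_conv_add_uminus add_ac)
qed

end
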